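(* Let $\underline{M}\in\mathfrak{M}\setminus\{RL^{\infty}\}$ and let $(\alpha,\beta)\in U$ be such that $K(\alpha,\beta)\succ\underline{M}$. Then $\Theta_{\underline{M}}(\alpha,\beta)\ne0$.
   Context: Let $U=\{(\alpha,\beta): 1/2<\beta\le 1,\ 1-\beta<\alpha<\beta\}$. For $(\alpha,\beta)\in U$ the skew tent map $T_{\alpha,\beta}:[0,1]\to[0,1]$ is $T_{\alpha,\beta}(x)=\frac{\beta}{\alpha}x$ for $0\le x\le\alpha$ and $T_{\alpha,\beta}(x)=\frac{\beta}{1-\alpha}(1-x)$ for $\alpha<x\le1$. The extended itinerary of $x\in[0,1]$ is the sequence indexed by $n\ge 0$ whose $n$-th entry is $L$, $C$ or $R$ according to whether $T_{\alpha,\beta}^n(x)<\alpha$, $=\alpha$ or $>\alpha$. The itinerary $\underline{I}_{\alpha,\beta}(x)$ is the extended itinerary if it contains no $C$; otherwise it is the finite string obtained by stopping at (and including) the first $C$. The kneading sequence is $K(\alpha,\beta)=\underline{I}_{\alpha,\beta}(\beta)$. $\mathfrak{M}$ is the set of all kneading sequences $K(1/2,\beta)$, $\beta\in(1/2,1]$. Ordering: $L\prec C\prec R$; for two different itineraries $\underline{A},\underline{B}$ let $n$ be the first index with $A_n\ne B_n$; if the number of $R$'s in $A_0\dots A_{n-1}$ is even, then $\underline{A}\prec\underline{B}$ iff $A_n\prec B_n$; if it is odd, then $\underline{A}\prec\underline{B}$ iff $B_n\prec A_n$. $\underline{A}\succ\underline{B}$ means $\underline{B}\prec\underline{A}$.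 For $\underline{M}\in\mathfrak{M}$ define the infinite $\{L,R\}$-sequence $\underline{M}^-$: if $\underline{M}$ is infinite (contains no $C$), $\underline{M}^-=\underline{M}$; if $\underline{M}=A_0\dots A_{n-1}C$ with $A_i\in\{L,R\}$, then $\underline{M}^-=(A_0\dots A_{n-1}L)^{\infty}$ when the number of $R$'s in $A_0\dots A_{n-1}$ is even, and $\underline{M}^-=(A_0\dots A_{n-1}R)^{\infty}$ when it is odd. For $\underline{M}\in\mathfrak{M}\setminus\{RL^{\infty}\}$ the sequence $\underline{M}^-$ starts with $R$ and contains infinitely many $R$'s, so it can be written uniquely as $\underline{M}^-=R\,L^{m_1}R\,L^{m_2}R\,L^{m_3}R\dots$ with integers $m_i\ge0$; put $\overline{m}_k=m_1+\dots+m_k$ and $$\Theta_{\underline{M}}(\alpha,\beta)=1-\beta+\sum_{k=1}^{\infty}(-1)^{k}\left(\frac{1-\alpha}{\beta}\right)^{k}\left(\frac{\alpha}{\beta}\right)^{\overline{m}_k}\qquad((\alpha,\beta)\in U).$$ *)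

theory Defs
  imports "HOL-Analysis.Analysis"
begin

definition U :: "(real \<times> real) set" where
  "U = {(\<alpha>, \<beta>). 1/2 < \<beta> \<and> \<beta> \<le> 1 \<and> 1 - \<beta> < \<alpha> \<and> \<alpha> < \<beta>}"

(* Total on the reals; only the restriction to [0,1] is meant, and for (\<alpha>, \<beta>) in U that interval
   is mapped into itself. *)
definition skew_tent :: "real \<Rightarrow> real \<Rightarrow> real \<Rightarrow> real" where
  "skew_tent \<alpha> \<beta> x = (if x \<le> \<alpha> then \<beta> / \<alpha> * x else \<beta> / (1 - \<alpha>) * (1 - x))"

datatype letter = L | C | R

definition letter_less :: "letter \<Rightarrow> letter \<Rightarrow> bool" where
  "letter_less a b \<longleftrightarrow> (a, b) \<in> {(L, C), (L, R), (C, R)}"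

definition extended_itinerary :: "real \<Rightarrow> real \<Rightarrow> real \<Rightarrow> nat \<Rightarrow> letter" where
  "extended_itinerary \<alpha> \<beta> x n =
     (let y = (skew_tent \<alpha> \<beta> ^^ n) x in if y < \<alpha> then L else if y = \<alpha> then C else R)"

(* A finite or infinite string: entry n is None when n lies beyond the end of the string. *)
type_synonym itinerary = "nat \<Rightarrow> letter option"

definition itinerary :: "real \<Rightarrow> real \<Rightarrow> real \<Rightarrow> itinerary" where
  "itinerary \<alpha> \<beta> x n =
     (if \<exists>k<n. extended_itinerary \<alpha> \<beta> x k = C then None else Some (extended_itinerary \<alpha> \<beta> x n))"

definition kneading :: "real \<Rightarrow> real \<Rightarrow> itinerary" where
  "kneading \<alpha> \<beta> = itinerary \<alpha> \<beta> \<beta>"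

definition kneading_set :: "itinerary set" where
  "kneading_set = {kneading (1/2) \<beta> | \<beta>. 1/2 < \<beta> \<and> \<beta> \<le> 1}"

definition RL_infinity :: itinerary where
  "RL_infinity n = Some (if n = 0 then R else L)"

definition R_count :: "itinerary \<Rightarrow> nat \<Rightarrow> nat" where
  "R_count A n = card {i. i < n \<and> A i = Some R}"

(* Strict parity-lexicographic order. An itinerary ends exactly at its first C, so none is a proper
   prefix of another: at the first index where two of them differ, both have an entry. *)
definition itin_less :: "itinerary \<Rightarrow> itinerary \<Rightarrow> bool" where
  "itin_less A B \<longleftrightarrow>
     (\<exists>n a b. (\<forall>i<n. A i = B i) \<and> A n = Some a \<and> B n = Some b \<and> a \<noteq> b \<and>
        (if even (R_count A n) then letter_less a b else letter_less b a))"

definition minus_seq :: "itinerary \<Rightarrow> nat \<Rightarrow> letter" where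
  "minus_seq M k =
     (if \<forall>i. M i \<noteq> Some C then the (M k)
      else let n = (LEAST i. M i = Some C); j = k mod (n + 1)
           in if j < n then the (M j) else if even (R_count M n) then L else R)"

(* For S = R L^(m 1) R L^(m 2) R ..., with k \<ge> 1, block_length S k is the exponent m k: the number of
   entries strictly between the k-th and the (k+1)-th R ("enumerate" counts from 0). *)
definition block_length :: "(nat \<Rightarrow> letter) \<Rightarrow> nat \<Rightarrow> nat" where
  "block_length S k = enumerate {n. S n = R} k - enumerate {n. S n = R} (k - 1) - 1"

definition block_sum :: "(nat \<Rightarrow> letter) \<Rightarrow> nat \<Rightarrow> nat" where
  "block_sum S k = (\<Sum>i=1..k. block_length S i)"

lemma R_iff_block_sum:
  assumes "S 0 = R" and inf: "infinite {n. S n = R}"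
  shows "S n = R \<longleftrightarrow> (\<exists>k. n = k + block_sum S k)"
proof -
  have pos: "enumerate {n. S n = R} k = k + block_sum S k" for k
  proof (induction k)
    case 0
    have "(LEAST n. S n = R) = 0"
      using assms(1) by (intro Least_eq_0)
    then show ?case by (simp add: enumerate_0 block_sum_def)
  next
    case (Suc k)
    have "enumerate {n. S n = R} k < enumerate {n. S n = R} (Suc k)"
      using inf by (rule enumerate_step)
    with Suc show ?case by (simp add: block_sum_def block_length_def)
  qed
  have "{n. S n = R} = range (enumerate {n. S n = R})"
    using inf by (simp add: range_enumerate)
  then show ?thesis by (auto simp: pos)
qed

(* The series index is shifted by one: the term for k is the mathematical term for k + 1. On U both
   base quotients lie in (0,1), so the series converges absolutely. *)
definition Theta :: "itinerary \<Rightarrow> real \<Rightarrow> real \<Rightarrow> real" where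
  "Theta M \<alpha> \<beta> = 1 - \<beta> +
     (\<Sum>k. (-1) ^ Suc k * ((1 - \<alpha>) / \<beta>) ^ Suc k * (\<alpha> / \<beta>) ^ block_sum (minus_seq M) (Suc k))"

end

theory Submission
  imports Defs
begin

text \<open>
  Let \<open>S = M\<^sup>-\<close>, and write \<open>f\<^sub>L(x) = (\<beta>/\<alpha>) x\<close> and \<open>f\<^sub>R(x) = (\<beta>/(1-\<alpha>)) (1-x)\<close> for the two
  affine branches of the skew tent map, extended to the whole line. Both slopes exceed \<open>1\<close>
  in absolute value on \<open>U\<close>, so there is exactly one point whose orbit stays bounded when \<open>f\<close>
  is applied along the letters of \<open>S\<close>. Expanding it by the inverse branches gives the series
  in \<open>\<Theta>\<close>, so \<open>\<Theta> = 0\<close> says that this point is \<open>\<beta>\<close> (\<open>Theta_eq_coded_point\<close>). Let \<open>y\<^sub>k\<close> be its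
  orbit; it is the orbit under prescribed branches and need not be an orbit of the skew tent
  map.

  The sequence \<open>S\<close> is maximal among its shifts (\<open>minus_seq_shift_maximal\<close>) and lies at or
  below \<open>M\<close>, so every shift of \<open>S\<close> lies strictly below \<open>K(\<alpha>,\<beta>)\<close>. Suppose \<open>y\<^sub>k \<ge> \<beta>\<close> and
  compare the orbit from \<open>y\<^sub>k\<close> with the true orbit of \<open>\<beta>\<close>. While the letters agree, the
  difference of the two orbits is expanded, and its sign changes at every \<open>R\<close>. At the first
  disagreement the parity order forces the prescribed letter to be the wrong one for the
  side of \<open>\<alpha>\<close> on which the prescribed orbit lies (or that orbit is at \<open>\<alpha>\<close> itself), so the
  next image exceeds the maximum \<open>\<beta>\<close> by at least an expansion factor times the sum of the
  original excess and the distance from the true orbit to \<open>\<alpha>\<close> (\<open>deviation_expands\<close>). Since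
  \<open>y\<close> is bounded, no \<open>y\<^sub>k\<close> can exceed \<open>\<beta>\<close>. Then \<open>y\<^sub>0 = \<beta>\<close> leaves a single possibility: the
  disagreement happens exactly where the true orbit hits \<open>\<alpha>\<close>, and the prescribed orbit
  returns to \<open>\<beta>\<close>. Repeating this, \<open>K(\<alpha>,\<beta>) = A C\<close> is finite and \<open>S = (A l)\<^sup>\<infinity>\<close> with the letter
  \<open>l\<close> that makes \<open>A l\<close> smaller than \<open>A C\<close> (\<open>below_kneading_imp_periodic\<close>).

  Finally, the map defining \<open>M\<close> is itself expanding, so periodicity of \<open>S\<close> makes its maximum
  value periodic with period \<open>|A| + 1\<close>, and its turning point is on that orbit. So \<open>M = B C\<close>
  with \<open>|B| \<le> |A|\<close> and \<open>B\<close> a prefix of \<open>A\<close>. If the lengths are equal then \<open>M = K(\<alpha>,\<beta>)\<close>; if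
  not, \<open>K(\<alpha>,\<beta>)\<close> continues \<open>B\<close> with the letter of \<open>S\<close>, the one that makes the sequence
  smaller, and \<open>K(\<alpha>,\<beta>)\<close> lies below \<open>M\<close>. Both contradict the hypothesis.
\<close>

section \<open>The order on itineraries\<close>

abbreviation lift :: "(nat \<Rightarrow> letter) \<Rightarrow> itinerary" where
  "lift S \<equiv> \<lambda>i. Some (S i)"

abbreviation shift :: "nat \<Rightarrow> (nat \<Rightarrow> 'a) \<Rightarrow> nat \<Rightarrow> 'a" where
  "shift k S \<equiv> \<lambda>i. S (k + i)"

lemma R_count_0 [simp]: "R_count A 0 = 0"
  by (simp add: R_count_def)

lemma R_count_Suc: "R_count A (Suc n) = R_count A n + (if A n = Some R then 1 else 0)"
proof -
  have "{i. i < Suc n \<and> A i = Some R} =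
      (if A n = Some R then insert n {i. i < n \<and> A i = Some R} else {i. i < n \<and> A i = Some R})"
    by (auto simp: less_Suc_eq)
  then show ?thesis by (simp add: R_count_def)
qed

lemma R_count_cong: "(\<And>i. i < n \<Longrightarrow> A i = B i) \<Longrightarrow> R_count A n = R_count B n"
  unfolding R_count_def by (metis (mono_tags, lifting))

lemma letter_less_simps [simp]:
  "letter_less L C" "letter_less L R" "letter_less C R"
  "\<not> letter_less C L" "\<not> letter_less R L" "\<not> letter_less R C" "\<not> letter_less a a"
  by (auto simp: letter_less_def)

lemma letter_less_trans: "letter_less a b \<Longrightarrow> letter_less b c \<Longrightarrow> letter_less a c"
  by (auto simp: letter_less_def)

lemma itin_less_trans:
  assumes "itin_less A B" "itin_less B D"
  shows "itin_less A D"
proof -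
  obtain n a b where n: "\<forall>i<n. A i = B i" "A n = Some a" "B n = Some b" "a \<noteq> b"
      "if even (R_count A n) then letter_less a b else letter_less b a"
    using assms(1) unfolding itin_less_def by blast
  obtain m c d where m: "\<forall>i<m. B i = D i" "B m = Some c" "D m = Some d" "c \<noteq> d"
      "if even (R_count B m) then letter_less c d else letter_less d c"
    using assms(2) unfolding itin_less_def by blast
  consider "n < m" | "n = m" | "m < n" by linarith
  then show ?thesis
  proof cases
    case 1
    then show ?thesis unfolding itin_less_def
      using n m by (intro exI[of _ n] exI[of _ a] exI[of _ b]) auto
  next
    case 2
    have "R_count A m = R_count B m" using n(1) 2 by (intro R_count_cong) auto
    moreover have "c = b" using n(3) m(2) 2 by simp
    ultimately have "if even (R_count A m) then letter_less a d else letter_less d a"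
      using n(5) m(5) 2 letter_less_trans by (auto split: if_splits)
    moreover from this have "a \<noteq> d" by (auto split: if_splits)
    ultimately show ?thesis unfolding itin_less_def
      using n m 2 by (intro exI[of _ m] exI[of _ a] exI[of _ d]) auto
  next
    case 3
    have "R_count A m = R_count B m" using n(1) 3 by (intro R_count_cong) auto
    then show ?thesis unfolding itin_less_def
      using n m 3 by (intro exI[of _ m] exI[of _ c] exI[of _ d]) auto
  qed
qed

lemma itin_less_linear:
  assumes "A \<noteq> B"
  shows "itin_less (lift A) (lift B) \<or> itin_less (lift B) (lift A)"
proof -
  define n where "n = (LEAST i. A i \<noteq> B i)"
  have "\<exists>i. A i \<noteq> B i" using assms by auto
  then have ne: "A n \<noteq> B n" unfolding n_def by (rule LeastI_ex)
  have eq: "\<forall>i<n. A i = B i" unfolding n_def using not_less_Least by blast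
  have "R_count (lift A) n = R_count (lift B) n" using eq by (intro R_count_cong) auto
  moreover have "letter_less (A n) (B n) \<or> letter_less (B n) (A n)"
    using ne by (cases "A n"; cases "B n") auto
  ultimately have "(if even (R_count (lift A) n) then letter_less (A n) (B n)
        else letter_less (B n) (A n)) \<or>
      (if even (R_count (lift B) n) then letter_less (B n) (A n) else letter_less (A n) (B n))"
    by auto
  then show ?thesis
  proof
    assume "if even (R_count (lift A) n) then letter_less (A n) (B n) else letter_less (B n) (A n)"
    then have "itin_less (lift A) (lift B)" unfolding itin_less_def
      using eq ne by (intro exI[of _ n] exI[of _ "A n"] exI[of _ "B n"]) simp
    then show ?thesis ..
  next
    assume "if even (R_count (lift B) n) then letter_less (B n) (A n) else letter_less (A n) (B n)"
    then have "itin_less (lift B) (lift A)" unfolding itin_less_def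
      using eq ne by (intro exI[of _ n] exI[of _ "B n"] exI[of _ "A n"]) simp
    then show ?thesis ..
  qed
qed

section \<open>Branches of skew tent maps\<close>

text \<open>The branches are defined on the whole line because the orbits of interest apply a prescribed
  branch even at points where the skew tent map uses the other one. The letter \<open>C\<close> gets the left
  branch by default; at the turning point the two branches agree.\<close>

definition branch :: "real \<Rightarrow> real \<Rightarrow> letter \<Rightarrow> real \<Rightarrow> real" where
  "branch a b l x = (if l = R then b / (1 - a) * (1 - x) else b / a * x)"

definition expansion :: "real \<Rightarrow> real \<Rightarrow> real" where
  "expansion a b = min (b / a) (b / (1 - a))"

lemma U_bounds:
  assumes "(a, b) \<in> U"
  shows "0 < a" "a < 1" "0 < b" "b \<le> 1" "a < b" "1 - a < b"
  using assms by (auto simp: U_def)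

lemma tent_in_U: "1/2 < b \<Longrightarrow> b \<le> 1 \<Longrightarrow> (1/2, b) \<in> U"
  by (auto simp: U_def)

lemma expansion_gt_1: "(a, b) \<in> U \<Longrightarrow> 1 < expansion a b"
  using U_bounds[of a b] by (auto simp: expansion_def)

text \<open>The inequalities are weak, so at the turning point either letter is admissible. This is what
  lets \<open>minus_seq\<close> replace each \<open>C\<close> by a letter and still describe a true orbit.\<close>

lemma skew_tent_eq_branch:
  assumes "(a, b) \<in> U" "l \<noteq> C" "l = L \<Longrightarrow> x \<le> a" "l = R \<Longrightarrow> a \<le> x"
  shows "skew_tent a b x = branch a b l x"
  using assms U_bounds[OF assms(1)]
  by (cases l; cases "x = a") (auto simp: skew_tent_def branch_def)

lemma skew_tent_range:
  assumes U: "(a, b) \<in> U" and x: "0 \<le> x" "x \<le> 1"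
  shows "0 \<le> skew_tent a b x" "skew_tent a b x \<le> b"
proof -
  note bounds = U_bounds[OF U]
  show "0 \<le> skew_tent a b x" using x bounds by (simp add: skew_tent_def)
  show "skew_tent a b x \<le> b"
  proof (cases "x \<le> a")
    case True
    then have "b / a * x \<le> b / a * a" using bounds by (intro mult_left_mono) auto
    with True show ?thesis using bounds by (simp add: skew_tent_def)
  next
    case False
    then have "b / (1 - a) * (1 - x) \<le> b / (1 - a) * (1 - a)"
      using bounds by (intro mult_left_mono) auto
    with False show ?thesis using bounds by (simp add: skew_tent_def)
  qed
qed

lemma skew_tent_eq_max_iff:
  assumes U: "(a, b) \<in> U"
  shows "skew_tent a b x = b \<longleftrightarrow> x = a"
proof -
  note bounds = U_bounds[OF U]
  have "b / a * x = b \<longleftrightarrow> x = a" using bounds by (simp add: field_simps)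
  moreover have "b / (1 - a) * (1 - x) = b \<longleftrightarrow> 1 - x = 1 - a"
    using bounds by (simp add: nonzero_divide_eq_eq)
  ultimately show ?thesis by (auto simp: skew_tent_def)
qed

lemma skew_tent_eq_0:
  assumes "(a, b) \<in> U" "skew_tent a b x = 0"
  shows "x = 0 \<or> x = 1"
  using assms(2) U_bounds[OF assms(1)] by (auto simp: skew_tent_def split: if_splits)

lemma orbit_range:
  assumes "(a, b) \<in> U"
  shows "0 \<le> (skew_tent a b ^^ n) b \<and> (skew_tent a b ^^ n) b \<le> b"
proof (induction n)
  case 0
  then show ?case using U_bounds[OF assms] by simp
next
  case (Suc n)
  then show ?case using skew_tent_range[OF assms] U_bounds[OF assms] by force
qed

text \<open>Each step multiplies the difference of two orbits by the slope of the common branch, which is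
  negative exactly for \<open>R\<close>. This is where the parity of the number of \<open>R\<close>'s, and with it the order on
  itineraries, meets the order of the line.\<close>

lemma branch_difference:
  assumes U: "(a, b) \<in> U"
    and "\<And>i. i < n \<Longrightarrow> x (Suc i) = branch a b (A i) (x i)"
    and "\<And>i. i < n \<Longrightarrow> y (Suc i) = branch a b (A i) (y i)"
  shows "\<exists>c \<ge> expansion a b ^ n. y n - x n = (-1) ^ R_count (lift A) n * c * (y 0 - x 0)"
  using assms(2,3)
proof (induction n)
  case 0
  show ?case by (intro exI[of _ 1]) auto
next
  case (Suc n)
  let ?e = "expansion a b"
  obtain c where c: "c \<ge> ?e ^ n" "y n - x n = (-1) ^ R_count (lift A) n * c * (y 0 - x 0)"
    using Suc by force
  define s where "s = (if A n = R then b / (1 - a) else b / a)"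
  have s: "s \<ge> ?e" by (simp add: s_def expansion_def)
  have e: "?e > 1" using expansion_gt_1[OF U] .
  have "s * c \<ge> ?e * ?e ^ n" using s c(1) e by (intro mult_mono) auto
  moreover have "y (Suc n) - x (Suc n) = (if A n = R then -1 else 1) * s * (y n - x n)"
    using Suc.prems by (simp add: branch_def s_def right_diff_distrib)
  ultimately show ?case
    by (intro exI[of _ "s * c"]) (auto simp: R_count_Suc c(2))
qed

lemma bounded_branch_orbit_unique:
  assumes U: "(a, b) \<in> U"
    and x: "\<And>i. x (Suc i) = branch a b (A i) (x i)" "\<And>i. \<bar>x i\<bar> \<le> B"
    and y: "\<And>i. y (Suc i) = branch a b (A i) (y i)" "\<And>i. \<bar>y i\<bar> \<le> B"
  shows "x 0 = y 0"
proof (rule ccontr)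
  assume ne: "x 0 \<noteq> y 0"
  let ?e = "expansion a b" and ?d = "\<bar>y 0 - x 0\<bar>"
  obtain n where n: "2 * B / ?d < ?e ^ n"
    using real_arch_pow[OF expansion_gt_1[OF U]] by blast
  obtain c where c: "c \<ge> ?e ^ n" "y n - x n = (-1) ^ R_count (lift A) n * c * (y 0 - x 0)"
    using branch_difference[OF U, of n x A y] x(1) y(1) by blast
  have "\<bar>y n - x n\<bar> = \<bar>c\<bar> * ?d" by (simp add: c(2) abs_mult power_abs)
  moreover have "2 * B < ?e ^ n * ?d" using n ne by (simp add: field_simps)
  moreover have "?e ^ n * ?d \<le> \<bar>c\<bar> * ?d" using c(1) by (intro mult_right_mono) auto
  ultimately show False using x(2)[of n] y(2)[of n] by linarith
qed

section \<open>The point coded by a sequence\<close>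

text \<open>The inverse branches are \<open>y \<mapsto> (\<alpha>/\<beta>) y\<close> and \<open>y \<mapsto> 1 - ((1-\<alpha>)/\<beta>) y\<close>. Composing them along
  \<open>S\<close>, the constant \<open>1\<close> enters once for every \<open>R\<close>, multiplied by the slopes of all earlier inverse
  branches; \<open>coded_point\<close> is the limit of these compositions.\<close>

definition inverse_slope :: "real \<Rightarrow> real \<Rightarrow> letter \<Rightarrow> real" where
  "inverse_slope a b l = (if l = R then - ((1 - a) / b) else a / b)"

definition weight :: "real \<Rightarrow> real \<Rightarrow> (nat \<Rightarrow> letter) \<Rightarrow> nat \<Rightarrow> real" where
  "weight a b S n = (\<Prod>i<n. inverse_slope a b (S i))"

definition coded_term :: "real \<Rightarrow> real \<Rightarrow> (nat \<Rightarrow> letter) \<Rightarrow> nat \<Rightarrow> real" where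
  "coded_term a b S n = (if S n = R then weight a b S n else 0)"

definition coded_point :: "real \<Rightarrow> real \<Rightarrow> (nat \<Rightarrow> letter) \<Rightarrow> real" where
  "coded_point a b S = (\<Sum>n. coded_term a b S n)"

lemma abs_coded_term_le:
  assumes "(a, b) \<in> U"
  shows "\<bar>coded_term a b S n\<bar> \<le> (1 / expansion a b) ^ n"
proof -
  have "\<bar>inverse_slope a b l\<bar> \<le> 1 / expansion a b" for l
    using U_bounds[OF assms] by (auto simp: inverse_slope_def expansion_def min_def field_simps)
  then have "(\<Prod>i<n. \<bar>inverse_slope a b (S i)\<bar>) \<le> (\<Prod>i<n. 1 / expansion a b)"
    by (intro prod_mono) auto
  then have "\<bar>weight a b S n\<bar> \<le> (1 / expansion a b) ^ n"
    by (simp add: weight_def abs_prod)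
  then show ?thesis
    using expansion_gt_1[OF assms] by (auto simp: coded_term_def)
qed

lemma
  assumes "(a, b) \<in> U"
  shows summable_coded_term: "summable (coded_term a b S)"
    and abs_coded_point_le: "\<bar>coded_point a b S\<bar> \<le> (\<Sum>n. (1 / expansion a b) ^ n)"
proof -
  have g: "summable (\<lambda>n. (1 / expansion a b) ^ n)"
    using expansion_gt_1[OF assms] by (intro summable_geometric) auto
  have n: "norm (coded_term a b S n) \<le> (1 / expansion a b) ^ n" for n
    using abs_coded_term_le[OF assms] by simp
  show s: "summable (coded_term a b S)"
    by (rule summable_comparison_test'[OF g, of 0]) (rule n)
  show "\<bar>coded_point a b S\<bar> \<le> (\<Sum>n. (1 / expansion a b) ^ n)"
    unfolding coded_point_def real_norm_def[symmetric] by (rule norm_suminf_le[OF n g])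
qed

text \<open>Splitting off the first term inverts the first inverse branch, so the points coded by the
  successive shifts form an orbit under the prescribed branches.\<close>

lemma coded_point_shift:
  assumes U: "(a, b) \<in> U"
  shows "coded_point a b (shift (Suc k) S) = branch a b (S k) (coded_point a b (shift k S))"
proof -
  let ?T = "shift k S" and ?T' = "shift (Suc k) S"
  have "weight a b ?T (Suc n) = inverse_slope a b (S k) * weight a b ?T' n" for n
    unfolding weight_def prod.lessThan_Suc_shift by simp
  then have "coded_term a b ?T (Suc n) = inverse_slope a b (S k) * coded_term a b ?T' n" for n
    by (simp add: coded_term_def)
  moreover have "(\<Sum>n. coded_term a b ?T (Suc n)) = coded_point a b ?T - coded_term a b ?T 0"
    unfolding coded_point_def by (rule suminf_split_head[OF summable_coded_term[OF U]])
  ultimately have "coded_point a b ?T =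
      coded_term a b ?T 0 + inverse_slope a b (S k) * coded_point a b ?T'"
    using suminf_mult[OF summable_coded_term[OF U, of ?T']] by (simp add: coded_point_def)
  moreover have "coded_term a b ?T 0 = (if S k = R then 1 else 0)"
    by (simp add: coded_term_def weight_def)
  ultimately show ?thesis
    using U_bounds[OF U] by (simp add: branch_def inverse_slope_def)
qed

text \<open>Up to the \<open>k\<close>-th \<open>R\<close>, counted from \<open>0\<close>, there are \<open>k\<close> letters \<open>R\<close> and as many other letters as the
  first \<open>k\<close> blocks contain, which turns the product of slopes into a summand of \<open>\<Theta>\<close>.\<close>

lemma weight_enumerate:
  assumes "S 0 = R" and inf: "infinite {n. S n = R}"
  shows "weight a b S (enumerate {n. S n = R} k) =
    (-1) ^ k * ((1 - a) / b) ^ k * (a / b) ^ block_sum S k"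
proof (induction k)
  case 0
  have "(LEAST n. S n = R) = 0" using assms(1) by (intro Least_eq_0)
  then show ?case by (simp add: enumerate_0 weight_def block_sum_def)
next
  case (Suc k)
  let ?e = "enumerate {n. S n = R}"
  let ?m = "block_length S (Suc k)"
  have lt: "?e k < ?e (Suc k)" using inf by (rule enumerate_step)
  have next_eq: "?e (Suc k) = Suc (?e k) + ?m"
    using lt by (simp add: block_length_def)
  have R: "S (?e k) = R" using enumerate_in_set[OF inf, of k] by simp
  \<comment> \<open>consecutive values of the enumeration leave no further \<open>R\<close> between them\<close>
  have notR: "S j \<noteq> R" if "?e k < j" "j < ?e (Suc k)" for j
    using that not_less_Least[of j "\<lambda>s. s \<in> {n. S n = R} \<and> ?e k < s"]
    by (simp add: enumerate_Suc''[OF inf])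
  have "weight a b S (Suc (?e k) + m) = weight a b S (?e k) * - ((1 - a) / b) * (a / b) ^ m"
    if "m \<le> ?m" for m
    using that
  proof (induction m)
    case 0
    show ?case by (simp add: weight_def R inverse_slope_def)
  next
    case (Suc m)
    have "S (Suc (?e k) + m) \<noteq> R" using Suc.prems next_eq by (intro notR) auto
    then have "weight a b S (Suc (?e k) + Suc m) = weight a b S (Suc (?e k) + m) * (a / b)"
      by (simp add: weight_def inverse_slope_def)
    then show ?case using Suc by simp
  qed
  from this[of ?m] show ?case
    unfolding next_eq Suc.IH by (simp add: block_sum_def power_add)
qed

text \<open>Only the positions of \<open>R\<close> contribute to the series of the coded point, so it can be summed
  along their enumeration. The first \<open>R\<close>, at position \<open>0\<close>, contributes the summand \<open>1\<close> of \<open>\<Theta>\<close>.\<close>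

lemma Theta_eq_coded_point:
  assumes U: "(a, b) \<in> U" and S0: "minus_seq M 0 = R" and inf: "infinite {n. minus_seq M n = R}"
  shows "Theta M a b = coded_point a b (minus_seq M) - b"
proof -
  let ?S = "minus_seq M" and ?e = "enumerate {n. minus_seq M n = R}"
  let ?f = "\<lambda>k. (-1) ^ k * ((1 - a) / b) ^ k * (a / b) ^ block_sum ?S k"
  have e: "strict_mono ?e" by (rule strict_mono_enumerate[OF inf])
  have r: "range ?e = {n. ?S n = R}" by (rule range_enumerate[OF inf])
  have z: "coded_term a b ?S n = 0" if "n \<notin> range ?e" for n
    using that by (simp add: r coded_term_def)
  have f: "coded_term a b ?S (?e k) = ?f k" for k
    using weight_enumerate[OF S0 inf] enumerate_in_set[OF inf, of k] by (simp add: coded_term_def)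
  have "summable ?f"
    using summable_mono_reindex[OF e, of "coded_term a b ?S"] z summable_coded_term[OF U, of ?S]
    by (simp add: f)
  then have "(\<Sum>k. ?f (Suc k)) = suminf ?f - ?f 0" by (rule suminf_split_head)
  moreover have "suminf ?f = coded_point a b ?S"
    using suminf_mono_reindex[OF e, of "coded_term a b ?S"] z by (simp add: f coded_point_def)
  ultimately show ?thesis by (simp add: Theta_def block_sum_def)
qed

section \<open>Sequences below the kneading sequence\<close>

lemma extended_itinerary_iff:
  "extended_itinerary a b x n = L \<longleftrightarrow> (skew_tent a b ^^ n) x < a"
  "extended_itinerary a b x n = C \<longleftrightarrow> (skew_tent a b ^^ n) x = a"
  "extended_itinerary a b x n = R \<longleftrightarrow> (skew_tent a b ^^ n) x > a"
  by (auto simp: extended_itinerary_def Let_def)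

lemma itinerary_eq_Some:
  "itinerary a b x n = Some l \<longleftrightarrow>
    (\<forall>k<n. extended_itinerary a b x k \<noteq> C) \<and> extended_itinerary a b x n = l"
  by (auto simp: itinerary_def)

text \<open>At the first disagreement, after an even number of \<open>R\<close>'s, the sequence has \<open>L\<close> while the true
  orbit of \<open>b\<close> is at or right of \<open>a\<close>. The difference from the true orbit has kept its sign, so the
  prescribed orbit is at least as far to the right, and the left branch takes it to at least \<open>b\<close>, its
  value at \<open>a\<close>. After an odd number of \<open>R\<close>'s everything is reflected. The term \<open>\<bar>t\<^sub>n - a\<bar>\<close>, with \<open>t\<^sub>n\<close> the
  true orbit, is kept because it shows later that the excess can vanish only if \<open>t\<^sub>n = a\<close>.\<close>

lemma deviation_expands:
  assumes U: "(a, b) \<in> U" and noC: "\<And>i. S i \<noteq> C"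
    and y: "\<And>i. y (Suc i) = branch a b (S i) (y i)" and y0: "b \<le> y 0"
    and less: "itin_less (lift S) (kneading a b)"
  shows "\<exists>n. (\<forall>i<n. kneading a b i = Some (S i)) \<and> kneading a b n \<noteq> None \<and>
    (kneading a b n = Some C \<longrightarrow> S n = (if even (R_count (kneading a b) n) then L else R)) \<and>
    y (Suc n) - b \<ge> expansion a b * (y 0 - b + \<bar>(skew_tent a b ^^ n) b - a\<bar>)"
proof -
  let ?K = "kneading a b" and ?t = "\<lambda>i. (skew_tent a b ^^ i) b"
  obtain n l where n: "\<forall>i<n. Some (S i) = ?K i" "?K n = Some l" "S n \<noteq> l"
      "if even (R_count (lift S) n) then letter_less (S n) l else letter_less l (S n)"
    using less unfolding itin_less_def by auto
  have Rc: "R_count (lift S) n = R_count ?K n" using n(1) by (intro R_count_cong) auto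
  have ext: "extended_itinerary a b b n = l" "\<And>i. i < n \<Longrightarrow> extended_itinerary a b b i \<noteq> C"
    using n(2) unfolding kneading_def itinerary_eq_Some by auto
  have S: "extended_itinerary a b b i = S i" if "i < n" for i
    using n(1) that unfolding kneading_def by (metis itinerary_eq_Some)
  have t: "?t (Suc i) = branch a b (S i) (?t i)" if "i < n" for i
    using S[OF that] ext(2)[OF that] skew_tent_eq_branch[OF U, of "S i" "?t i"]
      extended_itinerary_iff[of a b b i] by auto
  obtain c where c: "c \<ge> expansion a b ^ n"
      "y n - ?t n = (-1) ^ R_count (lift S) n * c * (y 0 - b)"
    using branch_difference[OF U, of n ?t S y] t y by auto
  have e: "expansion a b > 1" by (rule expansion_gt_1[OF U])
  then have "c \<ge> 1" using c(1) one_le_power[of "expansion a b" n] by linarith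
  then have c': "c * (y 0 - b) \<ge> y 0 - b" using y0 mult_right_mono[of 1 c "y 0 - b"] by simp
  note bounds = U_bounds[OF U]
  have "y (Suc n) - b \<ge> expansion a b * (y 0 - b + \<bar>?t n - a\<bar>)"
  proof (cases "even (R_count ?K n)")
    case True
    with n(4) Rc have "letter_less (S n) l" by simp
    then have Sn: "S n \<noteq> R" and "l \<noteq> L" by (auto simp: letter_less_def)
    then have "?t n \<ge> a" using ext(1) extended_itinerary_iff[of a b b n] by auto
    moreover have "y n - ?t n = c * (y 0 - b)" using c(2) True Rc by simp
    ultimately have le: "y 0 - b + \<bar>?t n - a\<bar> \<le> y n - a" using c' by linarith
    have "y (Suc n) - b = b / a * (y n - a)"
      using Sn bounds by (simp add: y branch_def field_simps)
    then show ?thesis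
      using le y0 e mult_mono[of "expansion a b" "b / a" "y 0 - b + \<bar>?t n - a\<bar>" "y n - a"]
      by (simp add: expansion_def)
  next
    case False
    with n(4) Rc have "letter_less l (S n)" by simp
    then have "S n = R" and "l \<noteq> R" using noC[of n] by (auto simp: letter_less_def)
    then have "?t n \<le> a" using ext(1) extended_itinerary_iff[of a b b n] by auto
    moreover have "y n - ?t n = - (c * (y 0 - b))" using c(2) False Rc by simp
    ultimately have le: "y 0 - b + \<bar>?t n - a\<bar> \<le> a - y n" using c' by linarith
    have "y (Suc n) - b = b / (1 - a) * (a - y n)"
      using \<open>S n = R\<close> bounds by (simp add: y branch_def field_simps)
    then show ?thesis
      using le y0 e mult_mono[of "expansion a b" "b / (1 - a)" "y 0 - b + \<bar>?t n - a\<bar>" "a - y n"]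
      by (simp add: expansion_def)
  qed
  then show ?thesis
    using n Rc noC[of n] by (intro exI[of _ n]) (auto simp: letter_less_def split: if_splits)
qed

text \<open>Iterating the previous lemma from a point above \<open>b\<close> would make the excess grow geometrically,
  against boundedness. Hence the orbit never exceeds \<open>b\<close>, and whenever it equals \<open>b\<close> the excess after
  the next disagreement is \<open>0\<close>: the orbit is back at \<open>b\<close>, the kneading sequence has reached its \<open>C\<close>, and
  the letters read in between are determined by the kneading sequence alone.\<close>

lemma below_kneading_imp_periodic:
  assumes U: "(a, b) \<in> U" and noC: "\<And>i. S i \<noteq> C"
    and y: "\<And>i. y (Suc i) = branch a b (S i) (y i)" and bdd: "\<And>i. \<bar>y i\<bar> \<le> B"
    and y0: "y 0 = b"
    and less: "\<And>k. itin_less (lift (shift k S)) (kneading a b)"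
  obtains n where "kneading a b n = Some C" and "\<And>i. i < n \<Longrightarrow> kneading a b i = Some (S i)"
    and "S n = (if even (R_count (kneading a b) n) then L else R)"
    and "\<And>i. S (Suc n + i) = S i"
proof -
  let ?K = "kneading a b" and ?t = "\<lambda>i. (skew_tent a b ^^ i) b" and ?e = "expansion a b"
  have e: "?e > 1" by (rule expansion_gt_1[OF U])
  have dev: "\<exists>n. (\<forall>i<n. ?K i = Some (S (k + i))) \<and> ?K n \<noteq> None \<and>
      (?K n = Some C \<longrightarrow> S (k + n) = (if even (R_count ?K n) then L else R)) \<and>
      y (Suc (k + n)) - b \<ge> ?e * (y k - b + \<bar>?t n - a\<bar>)" if k: "b \<le> y k" for k
  proof -
    have follows: "y (k + Suc i) = branch a b (S (k + i)) (y (k + i))" for i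
      using y[of "k + i"] by simp
    have start: "b \<le> y (k + 0)" using k by simp
    show ?thesis
      using deviation_expands[where S = "shift k S" and y = "shift k y", OF U noC follows start less]
      by simp
  qed
  have le: "y k \<le> b" for k
  proof (rule ccontr)
    assume k: "\<not> y k \<le> b"
    have "\<exists>j. y j - b \<ge> ?e ^ N * (y k - b)" for N
    proof (induction N)
      case 0
      show ?case by auto
    next
      case (Suc N)
      then obtain j where j: "y j - b \<ge> ?e ^ N * (y k - b)" by blast
      moreover have "?e ^ N * (y k - b) \<ge> 0" using k e by simp
      ultimately have "b \<le> y j" by linarith
      then obtain n where "y (Suc (j + n)) - b \<ge> ?e * (y j - b + \<bar>?t n - a\<bar>)"
        using dev[of j] by blast
      moreover have "?e * (y j - b + \<bar>?t n - a\<bar>) \<ge> ?e * (?e ^ N * (y k - b))"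
        using e j by (intro mult_left_mono) auto
      ultimately have "y (Suc (j + n)) - b \<ge> ?e ^ Suc N * (y k - b)" by simp
      then show ?case ..
    qed
    moreover obtain N where "(B + \<bar>b\<bar>) / (y k - b) < ?e ^ N"
      using real_arch_pow[OF e] by blast
    then have "B + \<bar>b\<bar> < ?e ^ N * (y k - b)" using k by (simp add: field_simps)
    ultimately obtain j where "B + \<bar>b\<bar> < y j - b" by (meson less_le_trans)
    with bdd[of j] show False by linarith
  qed
  have block: "\<exists>n. (\<forall>i<n. ?K i = Some (S (k + i))) \<and> ?K n = Some C \<and>
      S (k + n) = (if even (R_count ?K n) then L else R) \<and> y (Suc (k + n)) = b"
    if k: "y k = b" for k
  proof -
    obtain n where n: "\<forall>i<n. ?K i = Some (S (k + i))" "?K n \<noteq> None"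
        "?K n = Some C \<longrightarrow> S (k + n) = (if even (R_count ?K n) then L else R)"
        "y (Suc (k + n)) - b \<ge> ?e * (y k - b + \<bar>?t n - a\<bar>)"
      using dev[of k] k by auto
    have "?e * \<bar>?t n - a\<bar> \<le> 0" using n(4) k le[of "Suc (k + n)"] by simp
    then have t: "?t n = a" using e by (simp add: mult_le_0_iff)
    then have "?K n = Some C"
      using n(2) extended_itinerary_iff(2)[of a b b n]
      by (auto simp: kneading_def itinerary_def split: if_splits)
    moreover have "y (Suc (k + n)) = b" using n(4) k t le[of "Suc (k + n)"] by simp
    ultimately show ?thesis using n by auto
  qed
  obtain n where n: "\<forall>i<n. ?K i = Some (S i)" "?K n = Some C"
      "S n = (if even (R_count ?K n) then L else R)"
    using block[OF y0] by auto
  have uniq: "m = n" if "?K m = Some C" for m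
    using that n(2) unfolding kneading_def itinerary_eq_Some by (metis linorder_neqE_nat)
  have rep: "(\<forall>i\<le>n. S (k + i) = S i) \<and> y (k + Suc n) = b" if k: "y k = b" for k
  proof -
    obtain m where m: "\<forall>i<m. ?K i = Some (S (k + i))" "?K m = Some C"
        "S (k + m) = (if even (R_count ?K m) then L else R)" "y (Suc (k + m)) = b"
      using block[OF k] by auto
    with uniq have "m = n" by blast
    then show ?thesis using m n by (auto simp: le_less)
  qed
  have y_mult: "y (j * Suc n) = b" for j
  proof (induction j)
    case 0
    show ?case using y0 by simp
  next
    case (Suc j)
    then have "y (j * Suc n + Suc n) = b" using rep by blast
    then show ?case by (simp only: mult_Suc add.commute)
  qed
  have per: "S i = S (i mod Suc n)" for i
  proof -
    have "S (i div Suc n * Suc n + i mod Suc n) = S (i mod Suc n)"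
      using rep[OF y_mult, of "i div Suc n"] by (auto simp: less_Suc_eq_le[symmetric])
    then show ?thesis by (simp only: div_mult_mod_eq)
  qed
  have "S (Suc n + i) = S i" for i
    using per[of i] per[of "Suc n + i"] by (simp only: mod_add_self1)
  with n show ?thesis using that by blast
qed

section \<open>Kneading sequences and their infinite versions\<close>

text \<open>The facts about \<open>minus_seq\<close> hold for the kneading sequence of any skew tent map with parameters
  in \<open>U\<close>; the symmetric ones with \<open>a = 1/2\<close> are a special case.\<close>

lemma kneading_C_imp:
  assumes "kneading a b n = Some C"
  shows "(skew_tent a b ^^ n) b = a"
    and "i < n \<Longrightarrow> \<exists>l. l \<noteq> C \<and> extended_itinerary a b b i = l \<and> kneading a b i = Some l"
  using assms unfolding kneading_def itinerary_eq_Some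
  by (auto simp: extended_itinerary_iff)

lemma kneading_no_C_imp:
  assumes "\<forall>n. kneading a b n \<noteq> Some C"
  shows "extended_itinerary a b b i \<noteq> C" "kneading a b i = Some (extended_itinerary a b b i)"
proof -
  have *: "extended_itinerary a b b i \<noteq> C" for i
  proof (induction i rule: less_induct)
    case (less i)
    then show ?case using assms unfolding kneading_def itinerary_eq_Some by blast
  qed
  show "extended_itinerary a b b i \<noteq> C" by (rule *)
  show "kneading a b i = Some (extended_itinerary a b b i)"
    unfolding kneading_def itinerary_eq_Some using * by blast
qed

lemma minus_seq_no_C:
  assumes "\<forall>n. kneading a b n \<noteq> Some C"
  shows "minus_seq (kneading a b) i = extended_itinerary a b b i"
  using assms kneading_no_C_imp[OF assms] by (simp add: minus_seq_def)

lemma minus_seq_C: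
  assumes "kneading a b n = Some C"
  shows "minus_seq (kneading a b) k =
    (if k mod Suc n < n then extended_itinerary a b b (k mod Suc n)
     else if even (R_count (kneading a b) n) then L else R)"
proof -
  have "(LEAST i. kneading a b i = Some C) = n"
    using assms kneading_C_imp(2)[OF assms] by (intro Least_equality) (force intro: leI)+
  moreover have "the (kneading a b i) = extended_itinerary a b b i" if "i < n" for i
    using kneading_C_imp(2)[OF assms that] by auto
  ultimately show ?thesis using assms by (auto simp: minus_seq_def Let_def)
qed

lemma orbit_mod:
  assumes U: "(a, b) \<in> U" and "kneading a b n = Some C"
  shows "(skew_tent a b ^^ (k mod Suc n)) b = (skew_tent a b ^^ k) b"
proof (rule funpow_mod_eq)
  show "(skew_tent a b ^^ Suc n) b = b"
    using kneading_C_imp(1)[OF assms(2)] skew_tent_eq_max_iff[OF U] by simp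
qed

lemma minus_seq_codes_orbit:
  assumes U: "(a, b) \<in> U"
  shows "minus_seq (kneading a b) i \<noteq> C"
    and "minus_seq (kneading a b) i = L \<Longrightarrow> (skew_tent a b ^^ i) b \<le> a"
    and "minus_seq (kneading a b) i = R \<Longrightarrow> a \<le> (skew_tent a b ^^ i) b"
proof -
  let ?S = "minus_seq (kneading a b)" and ?t = "(skew_tent a b ^^ i) b"
  have "?S i \<noteq> C \<and> (?S i = L \<longrightarrow> ?t \<le> a) \<and> (?S i = R \<longrightarrow> a \<le> ?t)"
  proof (cases "\<exists>n. kneading a b n = Some C")
    case False
    then show ?thesis
      using minus_seq_no_C[of a b i] kneading_no_C_imp(1)[of a b i]
      by (auto simp: extended_itinerary_iff)
  next
    case True
    then obtain n where n: "kneading a b n = Some C" ..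
    let ?j = "i mod Suc n"
    have t: "?t = (skew_tent a b ^^ ?j) b" using orbit_mod[OF U n] by simp
    show ?thesis
    proof (cases "?j < n")
      case True
      then show ?thesis
        using kneading_C_imp(2)[OF n True] by (auto simp: minus_seq_C[OF n] t extended_itinerary_iff)
    next
      case False
      then have "?j = n" using mod_less_divisor[of "Suc n" i] by linarith
      then have "?t = a" using t kneading_C_imp(1)[OF n] by simp
      with False show ?thesis by (simp add: minus_seq_C[OF n])
    qed
  qed
  then show "?S i \<noteq> C" "?S i = L \<Longrightarrow> ?t \<le> a" "?S i = R \<Longrightarrow> a \<le> ?t" by auto
qed

lemma orbit_follows_minus_seq:
  assumes U: "(a, b) \<in> U"
  shows "(skew_tent a b ^^ Suc i) b = branch a b (minus_seq (kneading a b) i) ((skew_tent a b ^^ i) b)"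
  using skew_tent_eq_branch[OF U minus_seq_codes_orbit[OF U]] by simp

text \<open>In the finite case the letter replacing \<open>C\<close> is the one that makes the sequence smaller in the
  parity order.\<close>

lemma minus_seq_le_kneading:
  "lift (minus_seq (kneading a b)) = kneading a b \<or>
   itin_less (lift (minus_seq (kneading a b))) (kneading a b)"
proof (cases "\<exists>n. kneading a b n = Some C")
  case False
  then show ?thesis
    using minus_seq_no_C[of a b] kneading_no_C_imp(2)[of a b] by (auto simp: fun_eq_iff)
next
  case True
  let ?M = "kneading a b"
  let ?S = "lift (minus_seq ?M)"
  from True obtain n where n: "?M n = Some C" ..
  have eq: "\<forall>i<n. ?S i = ?M i"
    using kneading_C_imp(2)[OF n] by (auto simp: minus_seq_C[OF n])
  then have "R_count ?S n = R_count ?M n" by (intro R_count_cong) auto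
  moreover have "?S n = Some (if even (R_count ?M n) then L else R)"
    by (simp add: minus_seq_C[OF n])
  ultimately have "itin_less ?S ?M" unfolding itin_less_def
    using eq n by (intro exI[of _ n]) auto
  then show ?thesis ..
qed

text \<open>The sequence and its shift code the orbits of \<open>b\<close> and of an iterate \<open>t\<^sub>k\<close> of it. A larger
  shift would give \<open>t\<^sub>k \<ge> b\<close> by monotonicity, hence \<open>t\<^sub>k = b\<close>, as \<open>b\<close> is the maximum of the map. Then
  \<open>t\<^sub>k\<^sub>-\<^sub>1\<close> is the turning point, \<open>k\<close> is a multiple of the period of the sequence, and the shift
  is the sequence itself.\<close>

lemma minus_seq_shift_maximal:
  assumes U: "(a, b) \<in> U"
  shows "\<not> itin_less (lift (minus_seq (kneading a b))) (lift (shift k (minus_seq (kneading a b))))"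
proof
  let ?M = "kneading a b" and ?t = "\<lambda>i. (skew_tent a b ^^ i) b"
  let ?S = "minus_seq ?M"
  note codes = minus_seq_codes_orbit[OF U] and follows = orbit_follows_minus_seq[OF U]
  assume "itin_less (lift ?S) (lift (shift k ?S))"
  then obtain n where n: "\<forall>i<n. ?S i = ?S (k + i)" "?S n \<noteq> ?S (k + n)"
      "if even (R_count (lift ?S) n) then letter_less (?S n) (?S (k + n))
       else letter_less (?S (k + n)) (?S n)"
    unfolding itin_less_def by auto
  obtain c where c: "c \<ge> expansion a b ^ n"
      "?t (k + n) - ?t n = (-1) ^ R_count (lift ?S) n * c * (?t k - b)"
    using branch_difference[OF U, of n ?t ?S "shift k ?t"] follows n(1) by auto
  have c1: "c \<ge> 1"
    using c(1) expansion_gt_1[OF U] one_le_power[of "expansion a b" n] by linarith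
  have tk: "?t k \<le> b" using orbit_range[OF U] by blast
  have "c * (?t k - b) \<ge> 0"
  proof (cases "even (R_count (lift ?S) n)")
    case True
    then have "?S n = L" "?S (k + n) = R"
      using n(3) codes(1)[of n] codes(1)[of "k + n"] by (auto simp: letter_less_def)
    then show ?thesis using c(2) True codes(2)[of n] codes(3)[of "k + n"] by simp
  next
    case False
    then have "?S n = R" "?S (k + n) = L"
      using n(3) codes(1)[of n] codes(1)[of "k + n"] by (auto simp: letter_less_def)
    then show ?thesis using c(2) False codes(3)[of n] codes(2)[of "k + n"] by simp
  qed
  then have tkb: "?t k = b" using c1 tk by (simp add: zero_le_mult_iff)
  have "k \<noteq> 0" using n(2) by (metis add_0)
  have turning: "?t (k - 1) = a"
    using tkb \<open>k \<noteq> 0\<close> skew_tent_eq_max_iff[OF U, of "?t (k - 1)"] by (cases k) auto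
  then have "\<exists>p. ?M p = Some C"
    using kneading_no_C_imp(1)[of a b "k - 1"] by (auto simp: extended_itinerary_iff)
  then obtain p where p: "?M p = Some C" ..
  \<comment> \<open>otherwise the turning point would be reached before the first \<open>C\<close>, at position \<open>p\<close>\<close>
  have "k mod Suc p = 0"
  proof (rule ccontr)
    assume "k mod Suc p \<noteq> 0"
    then obtain r where r: "k mod Suc p = Suc r" by (cases "k mod Suc p") auto
    then have "r < p" by (metis Suc_less_eq mod_less_divisor zero_less_Suc)
    moreover have "?t (Suc r) = b" using orbit_mod[OF U p, of k] tkb r by simp
    then have "?t r = a" using skew_tent_eq_max_iff[OF U] by simp
    ultimately show False using kneading_C_imp(2)[OF p] by (auto simp: extended_itinerary_iff)
  qed
  then have "(k + n) mod Suc p = n mod Suc p" by (metis add_0 mod_add_left_eq)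
  then have "?S (k + n) = ?S n" by (simp add: minus_seq_C[OF p])
  with n(2) show False by simp
qed

lemma minus_seq_0:
  assumes U: "(a, b) \<in> U"
  shows "minus_seq (kneading a b) 0 = R"
  using minus_seq_codes_orbit(1,2)[OF U, of 0] U_bounds(5)[OF U]
  by (cases "minus_seq (kneading a b) 0") auto

text \<open>A tail consisting of \<open>L\<close> only codes the fixed point \<open>0\<close>, by expansion. The orbit starts at
  \<open>b > 0\<close>, so it can reach \<open>0\<close> only through \<open>1\<close>, which is possible only for \<open>b = 1\<close>; this is the map with
  kneading sequence \<open>RL\<^sup>\<infinity>\<close>.\<close>

lemma infinite_R_minus_seq:
  assumes U: "(a, b) \<in> U" and "kneading a b \<noteq> RL_infinity"
  shows "infinite {n. minus_seq (kneading a b) n = R}"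
proof
  let ?M = "kneading a b" and ?t = "\<lambda>i. (skew_tent a b ^^ i) b"
  let ?S = "minus_seq ?M"
  note bounds = U_bounds[OF U]
  assume "finite {n. ?S n = R}"
  then obtain k where k: "\<And>n. ?S n = R \<Longrightarrow> n < k"
    using finite_nat_set_iff_bounded by auto
  have no_C: "\<forall>n. ?M n \<noteq> Some C"
  proof (intro allI notI)
    fix n assume n: "?M n = Some C"
    have "?S (k * Suc n) = ?S 0" unfolding minus_seq_C[OF n] by (simp only: mod_mult_self2_is_0 mod_0)
    then have "k * Suc n < k" using minus_seq_0[OF U] by (intro k) metis
    then show False by simp
  qed
  have "?t (k + 0) = 0"
  proof (rule bounded_branch_orbit_unique[OF U, of "shift k ?t" "shift k ?S" 1 "\<lambda>_. 0"])
    show "?t (k + Suc i) = branch a b (?S (k + i)) (?t (k + i))" for i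
      using orbit_follows_minus_seq[OF U, of "k + i"] by simp
    show "\<bar>?t (k + i)\<bar> \<le> 1" for i using orbit_range[OF U, of "k + i"] bounds by simp
    show "0 = branch a b (?S (k + i)) 0" for i using k[of "k + i"] by (auto simp: branch_def)
  qed auto
  then have ex: "\<exists>m. ?t m = 0" by auto
  define m where "m = (LEAST m. ?t m = 0)"
  have m: "?t m = 0" unfolding m_def using ex by (rule LeastI_ex)
  then have "m \<noteq> 0" using bounds by (cases m) auto
  then obtain r where r: "m = Suc r" by (cases m) auto
  then have "?t r \<noteq> 0" using not_less_Least[of r "\<lambda>m. ?t m = 0"] m_def by simp
  moreover have "?t r = 0 \<or> ?t r = 1" using skew_tent_eq_0[OF U, of "?t r"] m r by simp
  ultimately have b: "b = 1" using orbit_range[OF U, of r] bounds by simp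
  have zero: "?t (Suc i) = 0" for i
    by (induction i) (use b bounds in \<open>auto simp: skew_tent_def\<close>)
  have "?M i = RL_infinity i" for i
  proof (cases i)
    case 0
    have "extended_itinerary a b b 0 = R" using bounds by (simp add: extended_itinerary_iff)
    then show ?thesis using kneading_no_C_imp(2)[OF no_C, of i] 0 by (simp add: RL_infinity_def)
  next
    case (Suc r)
    have "extended_itinerary a b b (Suc r) = L"
      using bounds zero[of r] by (simp only: extended_itinerary_iff)
    then show ?thesis using kneading_no_C_imp(2)[OF no_C, of i] Suc by (simp add: RL_infinity_def)
  qed
  with assms(2) show False by blast
qed

section \<open>Zeros of Theta\<close>

theorem theorem6:
  fixes M :: itinerary and \<alpha> \<beta> :: real
  assumes "M \<in> kneading_set - {RL_infinity}"
    and "(\<alpha>, \<beta>) \<in> U"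
    and "itin_less M (kneading \<alpha> \<beta>)"
  shows "Theta M \<alpha> \<beta> \<noteq> 0"
proof
  assume Theta_0: "Theta M \<alpha> \<beta> = 0"
  note U = assms(2)
  obtain b where "1/2 < b" "b \<le> 1" and M: "M = kneading (1/2) b"
    using assms(1) by (auto simp: kneading_set_def)
  then have U': "(1/2, b) \<in> U" by (intro tent_in_U)
  let ?S = "minus_seq M" and ?K = "kneading \<alpha> \<beta>" and ?t = "\<lambda>i. (skew_tent (1/2) b ^^ i) b"
  let ?y = "\<lambda>k. coded_point \<alpha> \<beta> (shift k ?S)"
  have S_no_C: "?S i \<noteq> C" for i using minus_seq_codes_orbit(1)[OF U'] M by simp
  have S_less: "itin_less (lift ?S) ?K"
    using minus_seq_le_kneading[of "1/2" b] assms(3) itin_less_trans M by metis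
  have shift_less: "itin_less (lift (shift k ?S)) ?K" for k
  proof (cases "shift k ?S = ?S")
    case True
    then show ?thesis using S_less by metis
  next
    case False
    then have "itin_less (lift (shift k ?S)) (lift ?S)"
      using itin_less_linear[of "shift k ?S" ?S] minus_seq_shift_maximal[OF U', of k] M by blast
    then show ?thesis using S_less by (rule itin_less_trans)
  qed
  have y_0: "?y 0 = \<beta>"
    using Theta_0 Theta_eq_coded_point[OF U, of M] minus_seq_0[OF U'] infinite_R_minus_seq[OF U']
      assms(1) M by simp
  obtain n where n: "?K n = Some C" "\<And>i. i < n \<Longrightarrow> ?K i = Some (?S i)"
      "?S n = (if even (R_count ?K n) then L else R)" "\<And>i. ?S (Suc n + i) = ?S i"
    using below_kneading_imp_periodic[OF U, of ?S ?y, OF S_no_C coded_point_shift[OF U]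
      abs_coded_point_le[OF U] y_0 shift_less] by blast
  \<comment> \<open>the orbit of \<open>b\<close> and its shift by a period of \<open>?S\<close> follow the same branches\<close>
  have "?t (Suc n + 0) = ?t 0"
  proof (rule bounded_branch_orbit_unique[OF U', of "shift (Suc n) ?t" ?S 1 ?t])
    show "?t (Suc n + Suc i) = branch (1/2) b (?S i) (?t (Suc n + i))" for i
      using orbit_follows_minus_seq[OF U', of "Suc n + i"] n(4)[of i] M by simp
    show "?t (Suc i) = branch (1/2) b (?S i) (?t i)" for i
      using orbit_follows_minus_seq[OF U', of i] M by simp
    show "\<bar>?t (Suc n + i)\<bar> \<le> 1" "\<bar>?t i\<bar> \<le> 1" for i
      using orbit_range[OF U', of "Suc n + i"] orbit_range[OF U', of i] \<open>b \<le> 1\<close> by simp_all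
  qed
  then have t_n: "?t n = 1/2" using skew_tent_eq_max_iff[OF U'] by simp
  then obtain m where m: "M m = Some C"
    using kneading_no_C_imp(1)[of "1/2" b n] M by (auto simp: extended_itinerary_iff)
  have "m \<le> n"
  proof (rule ccontr)
    assume "\<not> m \<le> n"
    then show False
      using kneading_C_imp(2)[of "1/2" b m n] m M t_n by (auto simp: extended_itinerary_iff)
  qed
  \<comment> \<open>\<open>M\<close> and \<open>?K\<close> both agree with \<open>?S\<close> before \<open>m\<close>, so they can differ first only at \<open>m\<close>\<close>
  obtain d x z where d: "\<forall>i<d. M i = ?K i" "M d = Some x" "?K d = Some z" "x \<noteq> z"
      "if even (R_count M d) then letter_less x z else letter_less z x"
    using assms(3) unfolding itin_less_def by blast
  have prefix: "M i = Some (?S i)" if "i < m" for i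
    using kneading_C_imp(2)[of "1/2" b m i] minus_seq_C[of "1/2" b m i] m M that by auto
  have S_m: "?S m = (if even (R_count M m) then L else R)"
    using minus_seq_C[of "1/2" b m m] m M by simp
  have "d \<le> m"
    using d(2) m unfolding M kneading_def itinerary_eq_Some by (meson not_le_imp_less)
  moreover have "\<not> d < m" using prefix n(2)[of d] \<open>m \<le> n\<close> d(2-4) by auto
  ultimately have "d = m" by simp
  have "m \<noteq> n" using d(2-4) m n(1) \<open>d = m\<close> by auto
  with \<open>m \<le> n\<close> have "z = ?S m" "x = C" using n(2)[of m] d(2,3) m \<open>d = m\<close> by auto
  then show False using d(5) S_m \<open>d = m\<close> by (auto split: if_splits)
qed

end
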